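(* Let $2\le m<n$ be integers, and let $E$ and $F$ be totally disconnected self-affine (Bedford–McMullen) carpets, both with expanding matrix $\mathrm{diag}(n,m)$. If $E\sim F$ (i.e. $E$ and $F$ are Lipschitz equivalent), then (i) $\mu_E$ and $\mu_F$ have the same multifractal spectrum; (ii) $\mu_E$ is doubling if and only if $\mu_F$ is doubling.
   Context: Let $2\le m<n$ be integers and let $\mathcal D\subset\{0,1,\dots,n-1\}\times\{0,1,\dots,m-1\}$ be a non-empty set (the digit set). For $d\in\mathcal D$ let $S_d(z)=\mathrm{diag}(n^{-1},m^{-1})(z+d)$ on $\mathbb R^2$. The self-affine carpet $E=K(n,m,\mathcal D)$ is the unique non-empty compact set with $E=\bigcup_{d\in\mathcal D}S_d(E)$; it is said to have expanding matrix $\mathrm{diag}(n,m)$. The uniform Bernoulli measure $\mu_E$ is the unique Borel probability measure on $E$ satisfying $\mu_E=\sum_{d\in\mathcal D}\frac1N\,\mu_E\circ S_d^{-1}$, $N=\#\mathcal D$; $\mu_F$ is defined likewise from the digit set of $F$. Lipschitz equivalence: metric spaces $X,Y$ satisfy $X\sim Y$ if there are a surjective map $f:X\to Y$ and a constant $C>0$ with $C^{-1}d_X(x,y)\le d_Y(f(x),f(y))\le C\,d_X(x,y)$ for all $x,y\in X$. Carpets carry the Euclidean metric. Multifractal spectrum: for a Borel measure $\mu$ on $E$ and $x\in E$, the local dimension is $d_\mu(x)=\lim_{r\to0}\frac{\log\mu(B(x,r)\cap E)}{\log r}$ whenever the limit exists, where $B(x,r)$ is the ball of center $x$ and radius $r$.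 For $\alpha\in\mathbb R$ let $X_{\alpha}=\{x\in E: d_\mu(x)\text{ exists and equals }\alpha\}$. The multifractal spectrum of $\mu$ is the function $\alpha\mapsto h_\mu(\alpha)=\dim_H X_\alpha$ (Hausdorff dimension). Doubling: a measure $\mu$ on a metric space $X$ is doubling if there is a constant $C\ge1$ such that $0<\mu(B(x,2r))\le C\mu(B(x,r))<\infty$ for all balls $B(x,r)\subset X$ of radius $r$. *)

theory Defs
  imports "HOL-Analysis.Analysis" "HOL-Probability.Probability_Measure"
begin

section \<open>Self-affine carpets and their uniform Bernoulli measures\<close>

text \<open>
  The plane is \<open>real \<times> real\<close>, whose library metric is the Euclidean one. A digit \<open>(i, j)\<close> has
  \<open>0 \<le> i < n\<close> (first coordinate, contracted by \<open>1/n\<close>) and \<open>0 \<le> j < m\<close> (second coordinate,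
  contracted by \<open>1/m\<close>).
\<close>

definition carpet_map :: "nat \<Rightarrow> nat \<Rightarrow> nat \<times> nat \<Rightarrow> real \<times> real \<Rightarrow> real \<times> real" where
  "carpet_map n m d z =
     ((fst z + real (fst d)) / real n, (snd z + real (snd d)) / real m)"

text \<open>
  By Hutchinson's theorem the conditions below determine \<open>E\<close>, and then the measure, uniquely
  (for \<open>n, m \<ge> 2\<close> and a non-empty digit set), and both exist.
\<close>

definition self_affine_carpet ::
    "nat \<Rightarrow> nat \<Rightarrow> (nat \<times> nat) set \<Rightarrow> (real \<times> real) set \<Rightarrow> bool" where
  "self_affine_carpet n m D E \<longleftrightarrow>
     D \<noteq> {} \<and> D \<subseteq> {0..<n} \<times> {0..<m} \<and>
     E \<noteq> {} \<and> compact E \<and> E = (\<Union>d\<in>D. carpet_map n m d ` E)"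

text \<open>
  The measure lives on the subspace \<open>E\<close>: its space is \<open>E\<close> and its measurable sets are the
  Borel subsets of \<open>E\<close>.
\<close>

definition uniform_bernoulli_measure ::
    "nat \<Rightarrow> nat \<Rightarrow> (nat \<times> nat) set \<Rightarrow> (real \<times> real) set \<Rightarrow> (real \<times> real) measure \<Rightarrow> bool"
  where
  "uniform_bernoulli_measure n m D E M \<longleftrightarrow>
     prob_space M \<and> sets M = sets (restrict_space borel E) \<and>
     (\<forall>A\<in>sets M. measure M A =
        (\<Sum>d\<in>D. 1 / real (card D) * measure M (carpet_map n m d -` A \<inter> E)))"


section \<open>Metric notions\<close>

definition totally_disconnected :: "'a::topological_space set \<Rightarrow> bool" where
  "totally_disconnected S \<longleftrightarrow> (\<forall>x\<in>S. connected_component_set S x = {x})"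

definition lipschitz_equivalent ::
    "'a::metric_space set \<Rightarrow> 'b::metric_space set \<Rightarrow> bool" where
  "lipschitz_equivalent X Y \<longleftrightarrow>
     (\<exists>f C. f ` X = Y \<and> C > 0 \<and>
        (\<forall>x\<in>X. \<forall>y\<in>X. inverse C * dist x y \<le> dist (f x) (f y) \<and>
                      dist (f x) (f y) \<le> C * dist x y))"


section \<open>Hausdorff dimension\<close>

text \<open>
  \<open>diam(U)\<^sup>s\<close> with the usual conventions \<open>diam({})\<^sup>s = 0\<close> and \<open>0\<^sup>0 = 1\<close> for non-empty \<open>U\<close>;
  the case split is needed because \<open>0 powr 0 = 0\<close>.
\<close>

definition diam_power :: "real \<Rightarrow> 'a::metric_space set \<Rightarrow> ennreal" where
  "diam_power s U =
     (if U = {} then 0 else if s = 0 then 1 else ennreal (diameter U powr s))"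

text \<open>
  Boundedness of the covering sets is explicit because \<open>diameter\<close> is meaningless on
  unbounded sets.
\<close>

definition hausdorff_premeasure :: "real \<Rightarrow> real \<Rightarrow> 'a::metric_space set \<Rightarrow> ennreal" where
  "hausdorff_premeasure s \<delta> A =
     (INF U\<in>{U :: nat \<Rightarrow> 'a set.
              A \<subseteq> (\<Union>i. U i) \<and> (\<forall>i. bounded (U i) \<and> diameter (U i) \<le> \<delta>)}.
        (\<Sum>i. diam_power s (U i)))"

definition hausdorff_measure :: "real \<Rightarrow> 'a::metric_space set \<Rightarrow> ennreal" where
  "hausdorff_measure s A = (SUP \<delta>\<in>{0<..}. hausdorff_premeasure s \<delta> A)"

definition hausdorff_dim :: "'a::metric_space set \<Rightarrow> ennreal" where
  "hausdorff_dim A = Inf {ennreal s |s. 0 \<le> s \<and> hausdorff_measure s A = 0}"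


section \<open>Multifractal spectrum and doubling measures\<close>

text \<open>
  Both notions are for a measure \<open>M\<close> on the metric subspace \<open>space M\<close>, whose balls are
  \<open>ball x r \<inter> space M\<close>. The positivity clause is needed because \<open>ln 0 = 0\<close>: at a point having
  a null ball the quotient is not a real number for small \<open>r\<close>, so no local dimension exists.
\<close>

definition has_local_dim :: "'a::metric_space measure \<Rightarrow> 'a \<Rightarrow> real \<Rightarrow> bool" where
  "has_local_dim M x \<alpha> \<longleftrightarrow>
     (\<forall>r>0. measure M (ball x r \<inter> space M) > 0) \<and>
     ((\<lambda>r. ln (measure M (ball x r \<inter> space M)) / ln r) \<longlongrightarrow> \<alpha>) (at_right 0)"

definition multifractal_spectrum :: "'a::metric_space measure \<Rightarrow> real \<Rightarrow> ennreal" where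
  "multifractal_spectrum M \<alpha> = hausdorff_dim {x \<in> space M. has_local_dim M x \<alpha>}"

definition doubling_measure :: "'a::metric_space measure \<Rightarrow> bool" where
  "doubling_measure M \<longleftrightarrow>
     (\<exists>C::real. C \<ge> 1 \<and> (\<forall>x\<in>space M. \<forall>r>0.
        0 < emeasure M (ball x (2 * r) \<inter> space M) \<and>
        emeasure M (ball x (2 * r) \<inter> space M)
          \<le> ennreal C * emeasure M (ball x r \<inter> space M) \<and>
        ennreal C * emeasure M (ball x r \<inter> space M) < \<infinity>))"

end

theory Submission
  imports Defs "HOL-Real_Asymp.Real_Asymp"
begin

text \<open>
  The uniform Bernoulli measure of a carpet is, up to bounded factors, a normalised covering
  number at small scales, and covering numbers are stable under bi-Lipschitz maps.

  At level \<open>L\<close> the carpet \<open>E\<close> is a union of \<open>N^L\<close> cylinders, each inside a rectangle of size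
  \<open>n^(-L)\<close> by \<open>m^(-L)\<close>. Choose \<open>q\<close> with \<open>m^(L+q)\<close> between \<open>n^L\<close> and \<open>m n^L\<close>. The rows of level \<open>q\<close>
  cut every cylinder of level \<open>L\<close> into the same number \<open>R\<close> of non-empty approximate squares of
  side about \<open>n^(-L)\<close>. Hence counting the cylinders in a family and counting its approximate squares differ
  only by the constant factor \<open>R\<close>. A map \<open>f\<close> from \<open>E\<close> onto \<open>F\<close> that contracts distances by a bounded
  factor at most sends boundedly many approximate squares of \<open>E\<close> into one of \<open>F\<close>. So if \<open>f\<close> maps
  the union of \<open>w\<close> cylinders of \<open>E\<close> into the union of \<open>w'\<close> cylinders of \<open>F\<close>, then
  \<open>w R \<le> k w' R'\<close> with \<open>k\<close> independent of \<open>L\<close> (\<open>cell_count_le\<close>). The same estimate for the inverse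
  map and all cylinders gives \<open>N'^L R' \<le> k N^L R\<close>. Dividing yields
  \<open>w / N^L \<le> k^2 w' / N'^L\<close>, in which the numbers of rows have disappeared.

  Since \<open>w / N^L\<close> bounds \<open>\<mu>\<^sub>E\<close> from above on every set met by only \<open>w\<close> cylinders, and
  \<open>w' / N'^L\<close> bounds \<open>\<mu>\<^sub>F\<close> from below on every set containing \<open>w'\<close> cylinders, taking \<open>L\<close> large
  compared with the radius shows that the \<open>\<mu>\<^sub>E\<close>-measure of the ball of radius \<open>r\<close> about \<open>x\<close> is at most
  a constant times the \<open>\<mu>\<^sub>F\<close>-measure of the ball of radius \<open>2 C r\<close> about \<open>f x\<close> (\<open>ball_measure_le\<close>),
  and symmetrically for \<open>f^(-1)\<close>.

  This comparison of balls carries local dimensions from \<open>x\<close> to \<open>f x\<close>, because a bounded factor in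
  the measure and in the radius disappears in the quotient of logarithms; it also carries
  the doubling inequality. As \<open>f\<close> then maps each level set of the local dimension onto the
  corresponding one, and bi-Lipschitz maps preserve Hausdorff dimension, the spectra agree.
\<close>

section \<open>Iterating a carpet\<close>

text \<open>
  The digit of a composition of two carpet maps: in each coordinate the outer digit is shifted
  past the inner one, as in a positional number system.
\<close>

definition compose_digits :: "nat \<Rightarrow> nat \<Rightarrow> (nat \<times> nat) \<times> (nat \<times> nat) \<Rightarrow> nat \<times> nat" where
  "compose_digits c e = (\<lambda>(d, p). (fst d * c + fst p, snd d * e + snd p))"

lemma carpet_map_compose:
  assumes "0 < c" "0 < e"
  shows "carpet_map a b d (carpet_map c e p z) = carpet_map (a * c) (b * e) (compose_digits c e (d, p)) z"
  using assms by (auto simp: carpet_map_def compose_digits_def field_simps)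

lemma radix_unique:
  fixes i j c u v :: nat
  assumes "i * c + u = j * c + v" "u < c" "v < c"
  shows "i = j" "u = v"
proof -
  have "(i * c + u) div c = i" "(j * c + v) div c = j"
    using assms(2,3) by auto
  then show "i = j" using assms(1) by simp
  then show "u = v" using assms(1) by simp
qed

lemma inj_on_compose_digits:
  assumes "D' \<subseteq> {0..<c} \<times> {0..<e}"
  shows "inj_on (compose_digits c e) (D \<times> D')"
proof (rule inj_onI)
  fix x y assume *: "x \<in> D \<times> D'" "y \<in> D \<times> D'" "compose_digits c e x = compose_digits c e y"
  obtain d p d' p' where xy: "x = (d, p)" "y = (d', p')" by (cases x, cases y) blast
  have "fst p < c" "fst p' < c" "snd p < e" "snd p' < e" using * assms xy by auto
  moreover have "fst d * c + fst p = fst d' * c + fst p'" "snd d * e + snd p = snd d' * e + snd p'"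
    using * xy by (auto simp: compose_digits_def)
  ultimately have "fst d = fst d'" "fst p = fst p'" "snd d = snd d'" "snd p = snd p'"
    using radix_unique by blast+
  then show "x = y" using xy by (simp add: prod_eq_iff)
qed

lemma self_affine_carpetD:
  assumes "self_affine_carpet a b D E"
  shows "D \<noteq> {}" "D \<subseteq> {0..<a} \<times> {0..<b}" "E \<noteq> {}" "compact E"
    and "(\<Union>d\<in>D. carpet_map a b d ` E) = E"
  using assms by (simp_all add: self_affine_carpet_def)

lemma carpet_digit_less:
  assumes "self_affine_carpet a b D E" "p \<in> D"
  shows "fst p < a" "snd p < b"
  using self_affine_carpetD(2)[OF assms(1)] assms(2) by auto

lemma carpet_image_subset:
  assumes "self_affine_carpet a b D E" "p \<in> D" "z \<in> E"
  shows "carpet_map a b p z \<in> E"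
  using assms unfolding self_affine_carpet_def by blast

lemma carpet_cover:
  assumes "self_affine_carpet a b D E" "z \<in> E"
  obtains p y where "p \<in> D" "y \<in> E" "z = carpet_map a b p y"
  using assms unfolding self_affine_carpet_def by blast

lemma carpet_finite_digits:
  assumes "self_affine_carpet a b D E" shows "finite D"
  using self_affine_carpetD(2)[OF assms] by (rule finite_subset) simp

lemma carpet_scale_pos:
  assumes "self_affine_carpet a b D E" shows "0 < a" "0 < b"
  using self_affine_carpetD(1)[OF assms] carpet_digit_less[OF assms] by fastforce+

text \<open>
  Substituting the equation \<open>E = (\<Union>p\<in>D'. S\<^sub>p(E))\<close> into \<open>E = (\<Union>d\<in>D. S\<^sub>d(E))\<close> exhibits \<open>E\<close> as a
  carpet with finer digits. In this way the cylinders of any level become the first-level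
  cylinders of a carpet of the same kind.
\<close>

lemma self_affine_carpet_compose:
  assumes D: "self_affine_carpet a b D E" and D': "self_affine_carpet c e D' E"
  shows "self_affine_carpet (a * c) (b * e) (compose_digits c e ` (D \<times> D')) E"
proof -
  have sub: "compose_digits c e ` (D \<times> D') \<subseteq> {0..<a * c} \<times> {0..<b * e}"
  proof (rule image_subsetI)
    fix x assume "x \<in> D \<times> D'"
    then obtain d p where x: "x = (d, p)" "d \<in> D" "p \<in> D'" by auto
    then have lt: "fst d < a" "snd d < b" "fst p < c" "snd p < e"
      using carpet_digit_less[OF D] carpet_digit_less[OF D'] by auto
    \<comment> \<open>In base \<open>k\<close>, the leading digit decides the comparison.\<close>
    have radix: "i * k + u < j * k" if "i < j" "u < k" for i j k u :: nat
    proof -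
      have "i * k + u < Suc i * k" using that by simp
      also have "\<dots> \<le> j * k" using that by (intro mult_le_mono1) simp
      finally show ?thesis .
    qed
    show "compose_digits c e x \<in> {0..<a * c} \<times> {0..<b * e}"
      using radix[OF lt(1,3)] radix[OF lt(2,4)] by (simp add: x compose_digits_def)
  qed
  have comp: "carpet_map (a * c) (b * e) (compose_digits c e (d, p)) z =
      carpet_map a b d (carpet_map c e p z)" for d p z
    using carpet_map_compose[OF carpet_scale_pos[OF D']] by simp
  have "(\<Union>q\<in>compose_digits c e ` (D \<times> D'). carpet_map (a * c) (b * e) q ` E) =
      (\<Union>d\<in>D. carpet_map a b d ` (\<Union>p\<in>D'. carpet_map c e p ` E))"
    by (force simp: comp)
  also have "\<dots> = E"
    using self_affine_carpetD(5)[OF D] self_affine_carpetD(5)[OF D'] by simp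
  finally show ?thesis
    using sub self_affine_carpetD[OF D] self_affine_carpetD[OF D']
    unfolding self_affine_carpet_def by blast
qed

lemma uniform_bernoulli_space:
  assumes "uniform_bernoulli_measure a b D E M"
  shows "space M = E"
  using assms unfolding uniform_bernoulli_measure_def
  by (metis Int_UNIV_right sets_eq_imp_space_eq space_borel space_restrict_space)

lemma uniform_bernoulli_preimage_measurable:
  assumes D: "self_affine_carpet a b D E" and M: "uniform_bernoulli_measure a b' D' E M"
    and "p \<in> D" "A \<in> sets M"
  shows "carpet_map a b p -` A \<inter> E \<in> sets M"
proof -
  have sM: "sets M = sets (restrict_space borel E)"
    using M unfolding uniform_bernoulli_measure_def by auto
  have "E \<in> sets borel" using self_affine_carpetD(4)[OF D] by (rule borel_compact)
  then have sM': "S \<in> sets M \<longleftrightarrow> S \<in> sets borel \<and> S \<subseteq> E" for S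
    unfolding sM by (subst sets_restrict_space_iff) auto
  have "continuous_on UNIV (carpet_map a b p)"
    unfolding carpet_map_def by (auto simp: divide_inverse intro!: continuous_intros)
  then have "carpet_map a b p \<in> borel_measurable borel" by (rule borel_measurable_continuous_onI)
  then have "carpet_map a b p -` A \<inter> space borel \<in> sets borel"
    by (rule measurable_sets) (use assms sM' in auto)
  then show ?thesis using \<open>E \<in> sets borel\<close> sM' by auto
qed

lemma uniform_bernoulli_compose:
  assumes D: "self_affine_carpet a b D E" and D': "self_affine_carpet c e D' E"
    and M: "uniform_bernoulli_measure a b D E M" and M': "uniform_bernoulli_measure c e D' E M"
  shows "uniform_bernoulli_measure (a * c) (b * e) (compose_digits c e ` (D \<times> D')) E M"
proof -
  let ?DD = "compose_digits c e ` (D \<times> D')"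
  have inj: "inj_on (compose_digits c e) (D \<times> D')"
    by (rule inj_on_compose_digits) (rule self_affine_carpetD(2)[OF D'])
  have card: "card ?DD = card D * card D'"
    using card_image[OF inj] by (simp add: card_cartesian_product)
  have step: "measure M A = (\<Sum>q\<in>?DD. 1 / real (card ?DD) * measure M (carpet_map (a*c) (b*e) q -` A \<inter> E))"
    if A: "A \<in> sets M" for A
  proof -
    have pre: "carpet_map c e p -` (carpet_map a b d -` A \<inter> E) \<inter> E =
        carpet_map (a * c) (b * e) (compose_digits c e (d, p)) -` A \<inter> E"
      if "p \<in> D'" for d p
      using carpet_image_subset[OF D' that]
      by (auto simp: carpet_map_compose[OF carpet_scale_pos[OF D'], symmetric])
    have "measure M A = (\<Sum>d\<in>D. 1 / real (card D) * measure M (carpet_map a b d -` A \<inter> E))"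
      using M A unfolding uniform_bernoulli_measure_def by blast
    also have "\<dots> = (\<Sum>d\<in>D. 1 / real (card D) * (\<Sum>p\<in>D'. 1 / real (card D') *
        measure M (carpet_map c e p -` (carpet_map a b d -` A \<inter> E) \<inter> E)))"
    proof (rule sum.cong[OF refl])
      fix d assume "d \<in> D"
      then have "carpet_map a b d -` A \<inter> E \<in> sets M"
        using uniform_bernoulli_preimage_measurable[OF D M _ A] by blast
      then show "1 / real (card D) * measure M (carpet_map a b d -` A \<inter> E) =
        1 / real (card D) * (\<Sum>p\<in>D'. 1 / real (card D') *
          measure M (carpet_map c e p -` (carpet_map a b d -` A \<inter> E) \<inter> E))"
        using M' unfolding uniform_bernoulli_measure_def by metis
    qed
    also have "\<dots> = (\<Sum>d\<in>D. \<Sum>p\<in>D'. 1 / real (card ?DD) *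
        measure M (carpet_map (a * c) (b * e) (compose_digits c e (d, p)) -` A \<inter> E))"
      unfolding sum_distrib_left card by (intro sum.cong refl, subst pre) simp_all
    also have "\<dots> = (\<Sum>x\<in>D \<times> D'. 1 / real (card ?DD) *
        measure M (carpet_map (a * c) (b * e) (compose_digits c e x) -` A \<inter> E))"
      by (simp add: sum.cartesian_product case_prod_unfold)
    also have "\<dots> = (\<Sum>q\<in>?DD. 1 / real (card ?DD) * measure M (carpet_map (a*c) (b*e) q -` A \<inter> E))"
      by (subst sum.reindex[OF inj]) simp
    finally show ?thesis .
  qed
  show ?thesis using M step unfolding uniform_bernoulli_measure_def by blast
qed

text \<open>
  The \<open>k\<close>-th iterate has expanding matrix \<open>diag(n^k, m^k)\<close> and the same Bernoulli measure, so
  each statement below about cylinders is proved for the first level only and then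
  used at all levels.
\<close>

lemma carpet_level:
  assumes D: "self_affine_carpet n m D E" and M: "uniform_bernoulli_measure n m D E M"
  shows "\<exists>G. self_affine_carpet (n ^ k) (m ^ k) G E \<and> uniform_bernoulli_measure (n ^ k) (m ^ k) G E M"
proof (induction k)
  case 0
  have id: "carpet_map 1 1 (0, 0) = id" by (auto simp: carpet_map_def)
  have "self_affine_carpet 1 1 {(0, 0)} E"
    using self_affine_carpetD(3,4)[OF D] id unfolding self_affine_carpet_def by simp
  moreover have "uniform_bernoulli_measure 1 1 {(0, 0)} E M"
    using M id uniform_bernoulli_space[OF M] sets.sets_into_space[of _ M]
    unfolding uniform_bernoulli_measure_def by (auto simp: Int_absorb2)
  ultimately show ?case by auto
next
  case (Suc k)
  then obtain G where "self_affine_carpet (n ^ k) (m ^ k) G E" "uniform_bernoulli_measure (n ^ k) (m ^ k) G E M"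
    by blast
  from self_affine_carpet_compose[OF D this(1)] uniform_bernoulli_compose[OF D this(1) M this(2)]
  show ?case unfolding power_Suc by blast
qed

text \<open>
  A coordinate attains its extreme values on the compact set \<open>E\<close>. The self-affine equation
  bounds the maximum \<open>s\<close> of a coordinate by \<open>(s + k - 1) / k\<close> and the minimum \<open>s\<close> from below by
  \<open>s / k\<close>, which forces them into the unit interval.
\<close>

lemma carpet_subset_unit_square:
  assumes D: "self_affine_carpet n m D E" and "2 \<le> n" "2 \<le> m"
  shows "E \<subseteq> {0..1} \<times> {0..1}"
proof -
  note E = self_affine_carpetD(4,3)[OF D] and dig = carpet_digit_less[OF D]
  have key: "g z \<in> {0..1}"
    if cont: "continuous_on E g" and k: "2 \<le> k" and z: "z \<in> E"
      and self: "\<And>z. z \<in> E \<Longrightarrow> \<exists>y\<in>E. \<exists>i<k. g z = (g y + real i) / real k"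
    for g :: "real \<times> real \<Rightarrow> real" and k :: nat and z
  proof -
    obtain u where u: "u \<in> E" "\<And>y. y \<in> E \<Longrightarrow> g y \<le> g u"
      using continuous_attains_sup[OF E cont] by blast
    obtain l where l: "l \<in> E" "\<And>y. y \<in> E \<Longrightarrow> g l \<le> g y"
      using continuous_attains_inf[OF E cont] by blast
    have k1: "0 < real k - 1" using k by auto
    obtain y i where y: "y \<in> E" "i < k" "g u = (g y + real i) / real k" using self u by blast
    then have "real k * g u \<le> g u + (real k - 1)" using u(2)[OF y(1)] k by (simp add: field_simps)
    then have "(real k - 1) * g u \<le> (real k - 1) * 1" by (simp add: algebra_simps)
    then have "g u \<le> 1" using k1 mult_le_cancel_left_pos by blast
    obtain y i where y: "y \<in> E" "i < k" "g l = (g y + real i) / real k" using self l by blast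
    then have "real k * g l \<ge> g l" using l(2)[OF y(1)] k by (simp add: field_simps)
    then have "(real k - 1) * g l \<ge> 0" by (simp add: algebra_simps)
    then have "g l \<ge> 0" using k1 by (simp add: zero_le_mult_iff)
    show ?thesis using \<open>g u \<le> 1\<close> \<open>0 \<le> g l\<close> u(2)[OF z] l(2)[OF z] by auto
  qed
  have "fst z \<in> {0..1} \<and> snd z \<in> {0..1}" if z: "z \<in> E" for z
  proof
    show "fst z \<in> {0..1}"
    proof (rule key[OF _ assms(2) z])
      fix z assume "z \<in> E"
      from carpet_cover[OF D this] show "\<exists>y\<in>E. \<exists>i<n. fst z = (fst y + real i) / real n"
        by (metis carpet_map_def dig fst_conv)
    qed (intro continuous_intros)
    show "snd z \<in> {0..1}"
    proof (rule key[OF _ assms(3) z])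
      fix z assume "z \<in> E"
      from carpet_cover[OF D this] show "\<exists>y\<in>E. \<exists>i<m. snd z = (snd y + real i) / real m"
        by (metis carpet_map_def dig snd_conv)
    qed (intro continuous_intros)
  qed
  then show ?thesis by (auto simp: mem_Times_iff)
qed

section \<open>Counting approximate squares\<close>

text \<open>
  Lattice cells are closed, so points of neighbouring cells may coincide; the counting argument
  therefore separates cells by the parity of their indices.
\<close>

definition in_cell :: "nat \<Rightarrow> nat \<Rightarrow> nat \<times> nat \<Rightarrow> real \<times> real \<Rightarrow> bool" where
  "in_cell a B c t \<longleftrightarrow>
     real (fst c) \<le> real a * fst t \<and> real a * fst t \<le> real (fst c) + 1 \<and>
     real (snd c) \<le> real B * snd t \<and> real B * snd t \<le> real (snd c) + 1"

text \<open>
  The approximate squares: the cylinder of a digit \<open>p\<close> is cut horizontally into strips of height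
  \<open>1 / (b e)\<close>, and only the row \<open>snd g\<close> of an inner digit matters for the strip. With \<open>a\<close> and \<open>b e\<close>
  of the same order, such a cell is nearly a square.
\<close>

lemma in_cell_cylinder:
  assumes D: "self_affine_carpet a b D E" and G: "self_affine_carpet c e G E"
    and E: "E \<subseteq> {0..1} \<times> {0..1}" and "g \<in> G" "z \<in> E"
  shows "in_cell a (b * e) (fst p, snd p * e + snd g) (carpet_map a b p (carpet_map c e g z))"
proof -
  let ?y = "carpet_map c e g z"
  have "?y \<in> E" using carpet_image_subset[OF G assms(4,5)] .
  then have "fst ?y \<in> {0..1}" "snd z \<in> {0..1}" using E assms(5) by (auto simp: mem_Times_iff)
  moreover have "real e * snd ?y = snd z + real (snd g)"
    using carpet_scale_pos[OF G] by (simp add: carpet_map_def)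
  moreover have "real (b * e) * snd (carpet_map a b p ?y) = real e * snd ?y + real (snd p * e)"
    using carpet_scale_pos[OF D] by (simp add: carpet_map_def field_simps)
  moreover have "real a * fst (carpet_map a b p ?y) = fst ?y + real (fst p)"
    using carpet_scale_pos[OF D] by (simp add: carpet_map_def)
  ultimately show ?thesis by (auto simp: in_cell_def)
qed

lemma dist_prod_le: "dist x y \<le> \<bar>fst x - fst y\<bar> + \<bar>snd x - snd y\<bar>" for x y :: "real \<times> real"
  unfolding dist_prod_def dist_real_def using sqrt_sum_squares_le_sum_abs by fastforce

lemma near_cells_eq:
  fixes i j :: nat and s t :: real
  assumes "real i \<le> s" "s \<le> real i + 1" "real j \<le> t" "t \<le> real j + 1"
    and "\<bar>s - t\<bar> < 1" "i mod 2 = j mod 2"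
  shows "i = j"
proof -
  have "real i < real j + 2" "real j < real i + 2" using assms by auto
  then have "i < j + 2" "j < i + 2" by linarith+
  then show ?thesis using assms(6) by presburger
qed

lemma same_floor_close:
  fixes s t :: real
  assumes "\<lfloor>real P * s\<rfloor> = \<lfloor>real P * t\<rfloor>" "0 < P"
  shows "\<bar>s - t\<bar> \<le> 1 / real P"
proof -
  have "\<bar>real P * s - real P * t\<bar> \<le> 1" using assms(1) by linarith
  then have "real P * \<bar>s - t\<bar> \<le> 1" by (metis abs_mult abs_of_nat right_diff_distrib')
  then show ?thesis using assms(2) by (simp add: field_simps)
qed

text \<open>
  In each approximate square of the cylinders \<open>W\<close> choose a point of \<open>E\<close>. Label the square by the
  approximate square of \<open>F\<close> containing the image of this point, by the position of the image
  in a subdivision of that square into \<open>P\<close> by \<open>P\<close> boxes, and by the parities of its own lattice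
  indices. Equal labels mean that the two images are so close that the points themselves
  differ by less than one cell in each direction; as the parities agree, the two
  squares are equal. So the labelling is injective, and the right-hand side bounds the number
  of labels: \<open>(P + 1)\<^sup>2\<close> because the upper and right edges of the closed square have an index
  of their own, and \<open>4\<close> for the parities.
\<close>

lemma cell_count_le:
  fixes f :: "real \<times> real \<Rightarrow> real \<times> real"
  assumes E: "E \<subseteq> {0..1} \<times> {0..1}" and F: "F \<subseteq> {0..1} \<times> {0..1}"
    and DE: "self_affine_carpet a b D E" and GE: "self_affine_carpet c e G E"
    and DF: "self_affine_carpet a b D' F" and GF: "self_affine_carpet c e G' F"
    and scale: "a \<le> b * e" "b * e \<le> m * a"
    and lip: "\<And>x y. x \<in> E \<Longrightarrow> y \<in> E \<Longrightarrow> dist x y \<le> C * dist (f x) (f y)"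
    and C: "0 < C" "C * (real m + 1) < real P"
    and W: "W \<subseteq> D" "W' \<subseteq> D'"
    and cover: "f ` (\<Union>p\<in>W. carpet_map a b p ` E) \<subseteq> (\<Union>p\<in>W'. carpet_map a b p ` F)"
  shows "card W * card (snd ` G) \<le> 4 * (P + 1)\<^sup>2 * (card W' * card (snd ` G'))"
proof -
  define B where "B = b * e"
  have a: "0 < a" "0 < B" "0 < e" using carpet_scale_pos[OF DE] carpet_scale_pos[OF GE] by (auto simp: B_def)
  have P: "0 < P" using C by (metis add_nonneg_pos less_trans mult_pos_pos of_nat_0_le_iff of_nat_0_less_iff zero_less_one)
  define cell where "cell x = (fst (fst x), snd (fst x) * e + snd x)" for x :: "(nat \<times> nat) \<times> nat"
  have ex1: "\<exists>t. t \<in> E \<and> t \<in> (\<Union>p\<in>W. carpet_map a b p ` E) \<and> in_cell a B (cell x) t"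
    if x: "x \<in> W \<times> snd ` G" for x
  proof -
    obtain p g where pg: "x = (p, snd g)" "p \<in> W" "g \<in> G" using x by auto
    obtain z where z: "z \<in> E" using self_affine_carpetD(3)[OF DE] by auto
    have y: "carpet_map c e g z \<in> E" using carpet_image_subset[OF GE] pg z by auto
    have "in_cell a B (cell x) (carpet_map a b p (carpet_map c e g z))"
      using in_cell_cylinder[OF DE GE E pg(3) z, of p] pg by (simp add: cell_def B_def)
    then show ?thesis using carpet_image_subset[OF DE _ y] pg y W by blast
  qed
  then obtain t where t: "\<And>x. x \<in> W \<times> snd ` G \<Longrightarrow> t x \<in> E"
      "\<And>x. x \<in> W \<times> snd ` G \<Longrightarrow> t x \<in> (\<Union>p\<in>W. carpet_map a b p ` E)"
      "\<And>x. x \<in> W \<times> snd ` G \<Longrightarrow> in_cell a B (cell x) (t x)"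
    by metis
  have ex2: "\<exists>y. y \<in> W' \<times> snd ` G' \<and> in_cell a B (cell y) (f (t x))"
    if x: "x \<in> W \<times> snd ` G" for x
  proof -
    have "f (t x) \<in> (\<Union>p\<in>W'. carpet_map a b p ` F)" using t(2)[OF x] cover by blast
    then obtain p s where ps: "p \<in> W'" "s \<in> F" "f (t x) = carpet_map a b p s" by blast
    obtain g z where gz: "g \<in> G'" "z \<in> F" "s = carpet_map c e g z" using carpet_cover[OF GF ps(2)] .
    have "in_cell a B (cell (p, snd g)) (f (t x))"
      using in_cell_cylinder[OF DF GF F gz(1,2), of p] ps gz by (simp add: cell_def B_def)
    then show ?thesis using ps gz by blast
  qed
  then obtain y where y: "\<And>x. x \<in> W \<times> snd ` G \<Longrightarrow> y x \<in> W' \<times> snd ` G'"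
      "\<And>x. x \<in> W \<times> snd ` G \<Longrightarrow> in_cell a B (cell (y x)) (f (t x))"
    by metis
  define box where "box x = (nat \<lfloor>real P * (real a * fst (f (t x)) - real (fst (cell (y x))))\<rfloor>,
     nat \<lfloor>real P * (real B * snd (f (t x)) - real (snd (cell (y x))))\<rfloor>)" for x
  define label where "label x = ((y x, box x), (fst (cell x) mod 2, snd (cell x) mod 2))" for x
  have boxnn: "0 \<le> real P * (real a * fst (f (t x)) - real (fst (cell (y x))))"
     "real P * (real a * fst (f (t x)) - real (fst (cell (y x)))) \<le> real P"
     "0 \<le> real P * (real B * snd (f (t x)) - real (snd (cell (y x))))"
     "real P * (real B * snd (f (t x)) - real (snd (cell (y x)))) \<le> real P"
     if "x \<in> W \<times> snd ` G" for x
    using y(2)[OF that] P unfolding in_cell_def by (auto intro!: mult_left_le)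
  have box: "box x \<in> {0..P} \<times> {0..P}" if "x \<in> W \<times> snd ` G" for x
    using boxnn[OF that] unfolding box_def by (simp add: nat_le_iff) linarith
  have inj: "inj_on label (W \<times> snd ` G)"
  proof (rule inj_onI)
    fix x x' assume x: "x \<in> W \<times> snd ` G" and x': "x' \<in> W \<times> snd ` G" and eq: "label x = label x'"
    have eqs: "y x = y x'" "box x = box x'" "fst (cell x) mod 2 = fst (cell x') mod 2"
      "snd (cell x) mod 2 = snd (cell x') mod 2"
      using eq by (auto simp: label_def)
    have "\<lfloor>real P * (real a * fst (f (t x)) - real (fst (cell (y x))))\<rfloor> =
          \<lfloor>real P * (real a * fst (f (t x')) - real (fst (cell (y x'))))\<rfloor>"
      using eqs(2) boxnn[OF x] boxnn[OF x'] unfolding box_def by (simp add: eq_nat_nat_iff)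
    from same_floor_close[OF this P] have d1: "\<bar>real a * fst (f (t x)) - real a * fst (f (t x'))\<bar> \<le> 1 / real P"
      using eqs(1) by simp
    have "\<lfloor>real P * (real B * snd (f (t x)) - real (snd (cell (y x))))\<rfloor> =
          \<lfloor>real P * (real B * snd (f (t x')) - real (snd (cell (y x'))))\<rfloor>"
      using eqs(2) boxnn[OF x] boxnn[OF x'] unfolding box_def by (simp add: eq_nat_nat_iff)
    from same_floor_close[OF this P] have d2: "\<bar>real B * snd (f (t x)) - real B * snd (f (t x'))\<bar> \<le> 1 / real P"
      using eqs(1) by simp
    \<comment> \<open>Both coordinates are measured in units of the smaller side \<open>1 / B\<close> of a cell; the other side
      is at most \<open>m\<close> times larger.\<close>
    have Bm: "real B \<le> real m * real a" "real a \<le> real B"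
      using scale unfolding B_def by (metis of_nat_le_iff of_nat_mult)+
    have "real B * \<bar>fst (f (t x)) - fst (f (t x'))\<bar> \<le> real m * real a * \<bar>fst (f (t x)) - fst (f (t x'))\<bar>"
      using Bm by (intro mult_right_mono) auto
    also have "\<dots> = real m * \<bar>real a * fst (f (t x)) - real a * fst (f (t x'))\<bar>"
      by (simp add: abs_mult mult.assoc flip: right_diff_distrib)
    also have "\<dots> \<le> real m * (1 / real P)" using d1 by (intro mult_left_mono) auto
    finally have e1: "real B * \<bar>fst (f (t x)) - fst (f (t x'))\<bar> \<le> real m / real P" by simp
    have e2: "real B * \<bar>snd (f (t x)) - snd (f (t x'))\<bar> \<le> 1 / real P"
      using d2 by (simp add: abs_mult flip: right_diff_distrib)
    have "real B * dist (f (t x)) (f (t x')) \<le>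
       real B * (\<bar>fst (f (t x)) - fst (f (t x'))\<bar> + \<bar>snd (f (t x)) - snd (f (t x'))\<bar>)"
      by (intro mult_left_mono dist_prod_le) auto
    also have "\<dots> \<le> (real m + 1) / real P"
      using e1 e2 by (simp add: distrib_left add_divide_distrib)
    finally have e3: "real B * dist (f (t x)) (f (t x')) \<le> (real m + 1) / real P" .
    have "real B * dist (t x) (t x') \<le> real B * (C * dist (f (t x)) (f (t x')))"
      using lip[OF t(1)[OF x] t(1)[OF x']] by (intro mult_left_mono) auto
    also have "\<dots> = C * (real B * dist (f (t x)) (f (t x')))" by simp
    also have "\<dots> \<le> C * ((real m + 1) / real P)" using e3 C by (intro mult_left_mono) auto
    also have "\<dots> < 1" using C P by (simp add: field_simps)
    finally have close: "real B * dist (t x) (t x') < 1" .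
    have "\<bar>real a * fst (t x) - real a * fst (t x')\<bar> = real a * \<bar>fst (t x) - fst (t x')\<bar>"
      by (simp add: abs_mult flip: right_diff_distrib)
    also have "\<dots> \<le> real B * dist (t x) (t x')"
      using Bm dist_fst_le[of "t x" "t x'"] by (intro mult_mono) (auto simp: dist_real_def)
    finally have c1: "\<bar>real a * fst (t x) - real a * fst (t x')\<bar> < 1" using close by simp
    have "\<bar>real B * snd (t x) - real B * snd (t x')\<bar> = real B * \<bar>snd (t x) - snd (t x')\<bar>"
      by (simp add: abs_mult flip: right_diff_distrib)
    also have "\<dots> \<le> real B * dist (t x) (t x')"
      using dist_snd_le[of "t x" "t x'"] by (intro mult_left_mono) (auto simp: dist_real_def)
    finally have c2: "\<bar>real B * snd (t x) - real B * snd (t x')\<bar> < 1" using close by simp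
    have "fst (cell x) = fst (cell x')"
      using near_cells_eq[OF _ _ _ _ c1 eqs(3)] t(3)[OF x] t(3)[OF x'] unfolding in_cell_def by auto
    moreover have "snd (cell x) = snd (cell x')"
      using near_cells_eq[OF _ _ _ _ c2 eqs(4)] t(3)[OF x] t(3)[OF x'] unfolding in_cell_def by auto
    moreover have "snd x < e" "snd x' < e"
      using x x' carpet_digit_less(2)[OF GE] by auto
    ultimately show "x = x'"
      using radix_unique[of "snd (fst x)" e "snd x" "snd (fst x')" "snd x'"] by (simp add: cell_def prod_eq_iff)
  qed
  have fin: "finite W'" "finite (snd ` G')"
    using W carpet_finite_digits[OF DF] carpet_finite_digits[OF GF] finite_subset by auto
  let ?T = "((W' \<times> snd ` G') \<times> ({0..P} \<times> {0..P})) \<times> ({0..<2::nat} \<times> {0..<2::nat})"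
  have "label ` (W \<times> snd ` G) \<subseteq> ?T"
  proof (rule image_subsetI)
    fix x assume "x \<in> W \<times> snd ` G"
    from y(1)[OF this] box[OF this] show "label x \<in> ?T" by (auto simp: label_def)
  qed
  then have "card (W \<times> snd ` G) \<le> card ?T"
    by (rule card_inj_on_le[OF inj]) (use fin in auto)
  then show ?thesis by (simp add: card_cartesian_product power2_eq_square algebra_simps)
qed

text \<open>
  The least power of \<open>m\<close> that reaches \<open>n^L\<close> overshoots it by a factor less than \<open>m\<close>, and its
  exponent is at least \<open>L\<close> because \<open>m < n\<close>.
\<close>

lemma exists_square_scale:
  fixes m n L :: nat
  assumes "2 \<le> m" "m < n"
  shows "\<exists>q. n ^ L \<le> m ^ L * m ^ q \<and> m ^ L * m ^ q \<le> m * n ^ L"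
proof -
  define K where "K = (LEAST k. n ^ L \<le> m ^ k)"
  have "n ^ L < m ^ (n ^ L)" using assms by (intro less_exp[THEN less_le_trans] power_mono) auto
  then have ex: "\<exists>k. n ^ L \<le> m ^ k" by (meson less_imp_le)
  have K: "n ^ L \<le> m ^ K" unfolding K_def using ex by (rule LeastI_ex)
  have "m ^ L \<le> n ^ L" using assms by (intro power_mono) auto
  then have "m ^ L \<le> m ^ K" using K by linarith
  then have "L \<le> K" using assms by simp
  have "m ^ K \<le> m * n ^ L"
  proof (cases K)
    case 0 then show ?thesis using assms by simp
  next
    case (Suc k)
    then have "\<not> n ^ L \<le> m ^ k" using not_less_Least[of k "\<lambda>k. n ^ L \<le> m ^ k"] K_def by auto
    then show ?thesis using Suc by simp
  qed
  then show ?thesis using K \<open>L \<le> K\<close> by (intro exI[of _ "K - L"]) (simp flip: power_add)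
qed

section \<open>Comparing the measures of balls\<close>

text \<open>
  A cylinder can have more measure than \<open>1 / card D\<close>, since cylinders may share boundary
  points. The self-affine equation nevertheless bounds the measure of \<open>A\<close> by counting
  cylinders, as a term vanishes unless its cylinder meets \<open>A\<close>; dually, in the next lemma, a term
  equals \<open>1 / card D\<close> if its cylinder lies in \<open>A\<close>.
\<close>

lemma uniform_bernoulli_le_count:
  assumes D: "self_affine_carpet a b D E" and M: "uniform_bernoulli_measure a b D E M" and A: "A \<in> sets M"
  shows "measure M A \<le> real (card {p \<in> D. carpet_map a b p ` E \<inter> A \<noteq> {}}) / real (card D)"
proof -
  interpret prob_space M using M unfolding uniform_bernoulli_measure_def by simp
  have fin: "finite D" using carpet_finite_digits[OF D] .
  let ?W = "{p \<in> D. carpet_map a b p ` E \<inter> A \<noteq> {}}"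
  have "measure M A = (\<Sum>d\<in>D. 1 / real (card D) * measure M (carpet_map a b d -` A \<inter> E))"
    using M A unfolding uniform_bernoulli_measure_def by blast
  also have "\<dots> \<le> (\<Sum>d\<in>D. if d \<in> ?W then 1 / real (card D) else 0)"
  proof (rule sum_mono)
    fix d assume "d \<in> D"
    show "1 / real (card D) * measure M (carpet_map a b d -` A \<inter> E) \<le> (if d \<in> ?W then 1 / real (card D) else 0)"
    proof (cases "d \<in> ?W")
      case True then show ?thesis using prob_le_1 by (auto intro: divide_right_mono)
    next
      case False
      then have "carpet_map a b d -` A \<inter> E = {}" using \<open>d \<in> D\<close> by blast
      then show ?thesis using False by simp
    qed
  qed
  also have "\<dots> = real (card ?W) / real (card D)"
    using fin by (subst sum.inter_filter[symmetric]) auto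
  finally show ?thesis .
qed

lemma uniform_bernoulli_ge_count:
  assumes D: "self_affine_carpet a b D E" and M: "uniform_bernoulli_measure a b D E M" and A: "A \<in> sets M"
    and W: "W \<subseteq> D" "(\<Union>p\<in>W. carpet_map a b p ` E) \<subseteq> A"
  shows "real (card W) / real (card D) \<le> measure M A"
proof -
  interpret prob_space M using M unfolding uniform_bernoulli_measure_def by simp
  have fin: "finite D" using carpet_finite_digits[OF D] .
  have "real (card W) / real (card D) = (\<Sum>d\<in>W. 1 / real (card D))" by simp
  also have "\<dots> = (\<Sum>d\<in>W. 1 / real (card D) * measure M (carpet_map a b d -` A \<inter> E))"
  proof (rule sum.cong[OF refl])
    fix d assume "d \<in> W"
    then have "carpet_map a b d -` A \<inter> E = space M" using W uniform_bernoulli_space[OF M] by blast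
    then show "1 / real (card D) = 1 / real (card D) * measure M (carpet_map a b d -` A \<inter> E)"
      using prob_space by simp
  qed
  also have "\<dots> \<le> (\<Sum>d\<in>D. 1 / real (card D) * measure M (carpet_map a b d -` A \<inter> E))"
    using fin W by (intro sum_mono2) auto
  also have "\<dots> = measure M A"
    using M A unfolding uniform_bernoulli_measure_def by metis
  finally show ?thesis .
qed

lemma cylinder_diameter:
  assumes "E \<subseteq> {0..1} \<times> {0..1}" "0 < b" "b \<le> a"
    and "x \<in> carpet_map a b p ` E" "y \<in> carpet_map a b p ` E"
  shows "dist x y \<le> 2 / real b"
proof -
  obtain u v where uv: "u \<in> E" "v \<in> E" "x = carpet_map a b p u" "y = carpet_map a b p v" using assms by blast
  have "u \<in> {0..1} \<times> {0..1}" "v \<in> {0..1} \<times> {0..1}" using uv(1,2) assms(1) by blast+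
  then have "\<bar>fst u - fst v\<bar> \<le> 1" "\<bar>snd u - snd v\<bar> \<le> 1" by (auto simp: mem_Times_iff)
  moreover have "fst x - fst y = (fst u - fst v) / real a" "snd x - snd y = (snd u - snd v) / real b"
    using uv by (simp_all add: carpet_map_def diff_divide_distrib add_divide_distrib)
  ultimately have "\<bar>fst x - fst y\<bar> \<le> 1 / real a" "\<bar>snd x - snd y\<bar> \<le> 1 / real b"
    using assms by (auto simp: abs_divide intro: divide_right_mono)
  moreover have "1 / real a \<le> 1 / real b" using assms by (simp add: frac_le)
  ultimately show ?thesis using dist_prod_le[of x y] by simp
qed

lemma uniform_bernoulli_ball_measurable:
  assumes "uniform_bernoulli_measure a b D E M"
  shows "ball x r \<inter> E \<in> sets M"
  using assms unfolding uniform_bernoulli_measure_def by (auto simp: sets_restrict_space)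

text \<open>
  The level \<open>L\<close> is chosen after \<open>x\<close> and \<open>r\<close>, so that thickening the ball to the cylinders \<open>W\<close> that
  meet it, and the image of these to the cylinders \<open>W'\<close> of \<open>F\<close>, costs less than the factor \<open>2\<close> in
  the radius. The constant \<open>\<kappa>\<close> does not depend on \<open>L\<close>.
\<close>

lemma ball_measure_le:
  fixes f g :: "real \<times> real \<Rightarrow> real \<times> real"
  assumes nm: "2 \<le> m" "m < n"
    and DE: "self_affine_carpet n m D E" and DF: "self_affine_carpet n m D' F"
    and ME: "uniform_bernoulli_measure n m D E M" and MF: "uniform_bernoulli_measure n m D' F M'"
    and img: "f ` E = F" "g ` F = E" and C: "1 \<le> C"
    and lip: "\<And>x y. x \<in> E \<Longrightarrow> y \<in> E \<Longrightarrow> dist (f x) (f y) \<le> C * dist x y"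
    and f_expand: "\<And>x y. x \<in> E \<Longrightarrow> y \<in> E \<Longrightarrow> dist x y \<le> C * dist (f x) (f y)"
    and g_expand: "\<And>x y. x \<in> F \<Longrightarrow> y \<in> F \<Longrightarrow> dist x y \<le> C * dist (g x) (g y)"
  shows "\<exists>\<kappa>>0. \<forall>x\<in>E. \<forall>r>0.
    measure M (ball x r \<inter> E) \<le> \<kappa> * measure M' (ball (f x) (2 * C * r) \<inter> F)"
proof -
  obtain P :: nat where P: "C * (real m + 1) < real P" using reals_Archimedean2 by blast
  define k0 where "k0 = 4 * (P + 1)\<^sup>2"
  have E: "E \<subseteq> {0..1} \<times> {0..1}" and F: "F \<subseteq> {0..1} \<times> {0..1}"
    using carpet_subset_unit_square[OF DE] carpet_subset_unit_square[OF DF] nm by auto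
  have "measure M (ball x r \<inter> E) \<le> (real k0)\<^sup>2 * measure M' (ball (f x) (2 * C * r) \<inter> F)"
    if x: "x \<in> E" and r: "0 < r" for x r
  proof -
    let ?A = "ball x r \<inter> E" and ?B = "ball (f x) (2 * C * r) \<inter> F"
    have A: "?A \<in> sets M" and B: "?B \<in> sets M'"
      using uniform_bernoulli_ball_measurable[OF ME] uniform_bernoulli_ball_measurable[OF MF] by auto
    have Cr: "0 < C * r" using C r by simp
    obtain L where L: "(2 * C + 2) / (C * r) < real m ^ L"
      using real_arch_pow[of "real m"] nm by auto
    then have small: "C * (2 / real (m ^ L)) + 2 / real (m ^ L) < C * r"
      using Cr nm by (simp add: field_simps)
    have mL: "0 < m ^ L" "m ^ L \<le> n ^ L" using nm by (auto intro: power_mono)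
    obtain q where q: "n ^ L \<le> m ^ L * m ^ q" "m ^ L * m ^ q \<le> m * n ^ L"
      using exists_square_scale[OF nm] by blast
    obtain DL where DL: "self_affine_carpet (n ^ L) (m ^ L) DL E" "uniform_bernoulli_measure (n ^ L) (m ^ L) DL E M"
      using carpet_level[OF DE ME] by blast
    obtain Dq where Dq: "self_affine_carpet (n ^ q) (m ^ q) Dq E"
      using carpet_level[OF DE ME] by blast
    obtain DL' where DL': "self_affine_carpet (n ^ L) (m ^ L) DL' F" "uniform_bernoulli_measure (n ^ L) (m ^ L) DL' F M'"
      using carpet_level[OF DF MF] by blast
    obtain Dq' where Dq': "self_affine_carpet (n ^ q) (m ^ q) Dq' F"
      using carpet_level[OF DF MF] by blast
    let ?S = "carpet_map (n ^ L) (m ^ L)"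
    define W where "W = {p \<in> DL. ?S p ` E \<inter> ?A \<noteq> {}}"
    define U where "U = (\<Union>p\<in>W. ?S p ` E)"
    define W' where "W' = {p \<in> DL'. ?S p ` F \<inter> f ` U \<noteq> {}}"
    have cyl: "?S p ` E \<subseteq> E" if "p \<in> W" for p
      using carpet_image_subset[OF DL(1), of p] that unfolding W_def by blast
    have fU: "f ` U \<subseteq> F" using cyl img(1) unfolding U_def by blast
    have cover: "f ` U \<subseteq> (\<Union>p\<in>W'. ?S p ` F)"
    proof
      fix y assume y: "y \<in> f ` U"
      then have "y \<in> F" using fU by (rule rev_subsetD)
      then obtain p where "p \<in> DL'" "y \<in> ?S p ` F" using carpet_cover[OF DL'(1)] by blast
      then show "y \<in> (\<Union>p\<in>W'. ?S p ` F)" using y by (unfold W'_def) blast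
    qed
    have C0: "0 < C" using C by simp
    have WD: "W \<subseteq> DL" "W' \<subseteq> DL'" by (auto simp: W_def W'_def)
    have count: "card W * card (snd ` Dq) \<le> k0 * (card W' * card (snd ` Dq'))"
      unfolding k0_def
      by (rule cell_count_le[OF E F DL(1) Dq DL'(1) Dq' q f_expand C0 P WD cover[unfolded U_def]])
    have "g ` (\<Union>p\<in>DL'. ?S p ` F) \<subseteq> (\<Union>p\<in>DL. ?S p ` E)"
      using self_affine_carpetD(5)[OF DL(1)] self_affine_carpetD(5)[OF DL'(1)] img by simp
    from cell_count_le[OF F E DL'(1) Dq' DL(1) Dq q g_expand C0 P subset_refl subset_refl this]
    have total: "card DL' * card (snd ` Dq') \<le> k0 * (card DL * card (snd ` Dq))"
      by (simp add: k0_def)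
    have pos: "0 < card DL" "0 < card DL'" "0 < card (snd ` Dq)" "0 < card (snd ` Dq')"
      using carpet_finite_digits[OF DL(1)] self_affine_carpetD(1)[OF DL(1)]
        carpet_finite_digits[OF DL'(1)] self_affine_carpetD(1)[OF DL'(1)]
        carpet_finite_digits[OF Dq] self_affine_carpetD(1)[OF Dq]
        carpet_finite_digits[OF Dq'] self_affine_carpetD(1)[OF Dq'] by (simp_all add: card_gt_0_iff)
    \<comment> \<open>Multiplying the two estimates lets the numbers of rows cancel.\<close>
    have "(card W * card DL') * (card (snd ` Dq) * card (snd ` Dq')) =
        (card W * card (snd ` Dq)) * (card DL' * card (snd ` Dq'))" by (simp add: ac_simps)
    also have "\<dots> \<le> (k0 * (card W' * card (snd ` Dq'))) * (k0 * (card DL * card (snd ` Dq)))"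
      using count total by (rule mult_le_mono)
    also have "\<dots> = (k0\<^sup>2 * (card W' * card DL)) * (card (snd ` Dq) * card (snd ` Dq'))"
      by (simp add: power2_eq_square ac_simps)
    finally have "card W * card DL' \<le> k0\<^sup>2 * (card W' * card DL)"
      using pos by simp
    then have "real (card W * card DL') \<le> real (k0\<^sup>2 * (card W' * card DL))"
      by (simp only: of_nat_le_iff)
    then have ratio: "real (card W) / real (card DL) \<le> (real k0)\<^sup>2 * (real (card W') / real (card DL'))"
      using pos by (simp add: field_simps)
    have "(\<Union>p\<in>W'. ?S p ` F) \<subseteq> ?B"
    proof
      fix y assume "y \<in> (\<Union>p\<in>W'. ?S p ` F)"
      then obtain p' where p': "p' \<in> W'" "y \<in> ?S p' ` F" by blast
      from p'(1) have "?S p' ` F \<inter> f ` U \<noteq> {}" by (simp add: W'_def)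
      then obtain w where w: "w \<in> ?S p' ` F" "w \<in> f ` U" by (meson disjoint_iff)
      from w(2) obtain z where "w = f z" "z \<in> U" by (rule imageE)
      with w(1) have z: "z \<in> U" "f z \<in> ?S p' ` F" by simp_all
      from z(1) obtain p where p: "p \<in> W" "z \<in> ?S p ` E" unfolding U_def by (rule UN_E)
      from p(1) have "?S p ` E \<inter> ?A \<noteq> {}" unfolding W_def by simp
      then obtain z' where z': "z' \<in> ?S p ` E" "z' \<in> ?A" by (meson disjoint_iff)
      have "z \<in> E" using cyl[OF p(1)] p(2) by (rule subsetD)
      have "dist x z \<le> dist x z' + dist z' z" by (rule dist_triangle)
      also have "\<dots> \<le> r + 2 / real (m ^ L)"
        using z'(2) cylinder_diameter[OF E mL z'(1) p(2)] by simp
      finally have xz: "C * dist x z \<le> C * (r + 2 / real (m ^ L))" using C by (intro mult_left_mono) auto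
      have "dist (f x) y \<le> dist (f x) (f z) + dist (f z) y" by (rule dist_triangle)
      also have "\<dots> \<le> C * dist x z + 2 / real (m ^ L)"
        using lip[OF x \<open>z \<in> E\<close>] cylinder_diameter[OF F mL z(2) p'(2)] by simp
      also have "\<dots> < 2 * C * r" using xz small by (simp add: distrib_left)
      finally have "y \<in> ball (f x) (2 * C * r)" by simp
      moreover have "p' \<in> DL'" using p'(1) WD(2) by (rule rev_subsetD)
      then have "y \<in> F" using p'(2) carpet_image_subset[OF DL'(1)] by blast
      ultimately show "y \<in> ?B" by (rule IntI)
    qed
    then have "real (card W') / real (card DL') \<le> measure M' ?B"
      by (rule uniform_bernoulli_ge_count[OF DL' B WD(2)])
    then have "(real k0)\<^sup>2 * (real (card W') / real (card DL')) \<le> (real k0)\<^sup>2 * measure M' ?B"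
      by (intro mult_left_mono) auto
    moreover have "measure M ?A \<le> real (card W) / real (card DL)"
      unfolding W_def by (rule uniform_bernoulli_le_count[OF DL A])
    ultimately show ?thesis using ratio by linarith
  qed
  moreover have "0 < (real k0)\<^sup>2" by (simp add: k0_def)
  ultimately show ?thesis by blast
qed

section \<open>Bi-Lipschitz invariants\<close>

text \<open>
  Enlarging the constant to at least \<open>1\<close> covers the one-point case, where any positive constant
  is admissible, and makes the two directions symmetric.
\<close>

lemma lipschitz_equivalent_inverse_pair:
  assumes "lipschitz_equivalent X Y"
  obtains f g C where "f ` X = Y" "g ` Y = X" "1 \<le> C"
    and "\<And>x. x \<in> X \<Longrightarrow> g (f x) = x" "\<And>y. y \<in> Y \<Longrightarrow> f (g y) = y"
    and "\<And>x y. x \<in> X \<Longrightarrow> y \<in> X \<Longrightarrow> dist (f x) (f y) \<le> C * dist x y"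
    and "\<And>x y. x \<in> Y \<Longrightarrow> y \<in> Y \<Longrightarrow> dist (g x) (g y) \<le> C * dist x y"
proof -
  obtain f C where f: "f ` X = Y" "C > 0"
    and low: "\<And>x y. x \<in> X \<Longrightarrow> y \<in> X \<Longrightarrow> inverse C * dist x y \<le> dist (f x) (f y)"
    and up: "\<And>x y. x \<in> X \<Longrightarrow> y \<in> X \<Longrightarrow> dist (f x) (f y) \<le> C * dist x y"
    using assms unfolding lipschitz_equivalent_def by blast
  have low': "dist x y \<le> C * dist (f x) (f y)" if "x \<in> X" "y \<in> X" for x y
    using low[OF that] f(2) by (simp add: field_simps)
  have inj: "inj_on f X"
    using low' by (intro inj_onI) fastforce
  let ?C = "max 1 C" and ?g = "inv_into X f"
  have mono: "C * dist x y \<le> ?C * dist x y" for x y :: "'c::metric_space"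
    by (intro mult_right_mono) auto
  have g: "?g ` Y = X" "\<And>x. x \<in> X \<Longrightarrow> ?g (f x) = x" "\<And>y. y \<in> Y \<Longrightarrow> f (?g y) = y"
    using f inj inv_into_image_cancel[OF inj subset_refl] by (auto intro: f_inv_into_f)
  show ?thesis
  proof (rule that[of f ?g ?C])
    fix x y assume "x \<in> X" "y \<in> X"
    then show "dist (f x) (f y) \<le> ?C * dist x y" using up mono order_trans by blast
  next
    fix x y assume xy: "x \<in> Y" "y \<in> Y"
    then have "?g x \<in> X" "?g y \<in> X" using g by auto
    from low'[OF this] show "dist (?g x) (?g y) \<le> ?C * dist x y"
      using g(3) xy mono[of x y] by simp
  qed (use f g in auto)
qed

text \<open>
  The sets of a cover need not lie in \<open>A\<close>, where alone \<open>f\<close> is controlled; they are cut down to \<open>A\<close>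
  before being mapped. For \<open>s = 0\<close> the third estimate only says that a non-empty image comes
  from a non-empty set.
\<close>

lemma diam_power_image_le:
  fixes f :: "'a::metric_space \<Rightarrow> 'b::metric_space"
  assumes "0 \<le> s" "0 < C" "bounded U"
    and lip: "\<And>x y. x \<in> A \<Longrightarrow> y \<in> A \<Longrightarrow> dist (f x) (f y) \<le> C * dist x y"
  shows "bounded (f ` (U \<inter> A))" "diameter (f ` (U \<inter> A)) \<le> C * diameter U"
    and "diam_power s (f ` (U \<inter> A)) \<le> ennreal (C powr s) * diam_power s U"
proof -
  have d: "dist (f x) (f y) \<le> C * diameter U" if "x \<in> U \<inter> A" "y \<in> U \<inter> A" for x y
  proof -
    have "dist (f x) (f y) \<le> C * dist x y" using lip that by auto
    also have "\<dots> \<le> C * diameter U"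
      using diameter_bounded_bound[OF assms(3)] that assms(2) by (intro mult_left_mono) auto
    finally show ?thesis .
  qed
  show bdd: "bounded (f ` (U \<inter> A))"
    using d by (auto simp: bounded_two_points)
  have nn: "0 \<le> C * diameter U" using assms(2) diameter_ge_0[OF assms(3)] by simp
  show diam: "diameter (f ` (U \<inter> A)) \<le> C * diameter U"
  proof (cases "f ` (U \<inter> A) = {}")
    case True
    then show ?thesis using nn by (simp only: diameter_empty)
  next
    case False
    then show ?thesis
      unfolding diameter_def[of "f ` (U \<inter> A)"] using d by (auto intro!: cSUP_least)
  qed
  show "diam_power s (f ` (U \<inter> A)) \<le> ennreal (C powr s) * diam_power s U"
  proof (cases "U \<inter> A = {} \<or> s = 0")
    case True then show ?thesis using assms by (auto simp: diam_power_def)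
  next
    case False
    have "diameter (f ` (U \<inter> A)) powr s \<le> (C * diameter U) powr s"
      using diam assms diameter_ge_0[OF bdd] by (intro powr_mono2) auto
    also have "\<dots> = C powr s * diameter U powr s"
      by (rule powr_mult)
    finally show ?thesis using False assms
      by (auto simp: diam_power_def simp flip: ennreal_mult)
  qed
qed

lemma hausdorff_premeasure_lipschitz_image:
  fixes f :: "'a::metric_space \<Rightarrow> 'b::metric_space"
  assumes "0 \<le> s" "0 < C"
    and lip: "\<And>x y. x \<in> A \<Longrightarrow> y \<in> A \<Longrightarrow> dist (f x) (f y) \<le> C * dist x y"
  shows "hausdorff_premeasure s (C * \<delta>) (f ` A) \<le> ennreal (C powr s) * hausdorff_premeasure s \<delta> A"
proof -
  let ?cov = "\<lambda>\<delta> A. {U. A \<subseteq> (\<Union>i. U i) \<and> (\<forall>i::nat. bounded (U i) \<and> diameter (U i) \<le> \<delta>)}"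
  have "hausdorff_premeasure s (C * \<delta>) (f ` A) \<le> ennreal (C powr s) * (\<Sum>i. diam_power s (U i))"
    if U: "U \<in> ?cov \<delta> A" for U
  proof -
    let ?V = "\<lambda>i. f ` (U i \<inter> A)"
    have V: "bounded (?V i)" "diameter (?V i) \<le> C * diameter (U i)"
        "diam_power s (?V i) \<le> ennreal (C powr s) * diam_power s (U i)" for i
      using diam_power_image_le[OF assms(1,2) _ lip, of "U i"] U by auto
    have "diameter (?V i) \<le> C * \<delta>" for i
      using V(2)[of i] U assms(2) by (smt (verit) mem_Collect_eq mult_left_mono)
    moreover have "f ` A \<subseteq> (\<Union>i. ?V i)" using U by blast
    ultimately have "?V \<in> ?cov (C * \<delta>) (f ` A)" using V(1) by simp
    then have "hausdorff_premeasure s (C * \<delta>) (f ` A) \<le> (\<Sum>i. diam_power s (?V i))"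
      unfolding hausdorff_premeasure_def by (rule INF_lower)
    also have "\<dots> \<le> (\<Sum>i. ennreal (C powr s) * diam_power s (U i))"
      using V(3) by (intro suminf_le) auto
    also have "\<dots> = ennreal (C powr s) * (\<Sum>i. diam_power s (U i))" by (rule ennreal_suminf_cmult)
    finally show ?thesis .
  qed
  note le = this
  let ?c = "ennreal (C powr s)" and ?d = "ennreal (1 / C powr s)"
  \<comment> \<open>The factor is moved across the infimum by multiplying with its inverse.\<close>
  have one: "?c * ?d = 1"
    using assms(2) by (simp flip: ennreal_mult)
  have "?d * hausdorff_premeasure s (C * \<delta>) (f ` A) \<le> hausdorff_premeasure s \<delta> A"
    unfolding hausdorff_premeasure_def[of s \<delta> A]
  proof (rule INF_greatest)
    fix U assume "U \<in> ?cov \<delta> A"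
    then have "?d * hausdorff_premeasure s (C * \<delta>) (f ` A) \<le> ?d * (?c * (\<Sum>i. diam_power s (U i)))"
      using le by (intro mult_left_mono) auto
    also have "\<dots> = (\<Sum>i. diam_power s (U i))"
      using one by (metis mult.assoc mult.commute mult_1)
    finally show "?d * hausdorff_premeasure s (C * \<delta>) (f ` A) \<le> (\<Sum>i. diam_power s (U i))" .
  qed
  then have "?c * (?d * hausdorff_premeasure s (C * \<delta>) (f ` A)) \<le> ?c * hausdorff_premeasure s \<delta> A"
    by (intro mult_left_mono) auto
  then show ?thesis using one by (simp flip: mult.assoc)
qed

lemma hausdorff_dim_lipschitz_image:
  fixes f :: "'a::metric_space \<Rightarrow> 'b::metric_space"
  assumes "0 < C"
    and lip: "\<And>x y. x \<in> A \<Longrightarrow> y \<in> A \<Longrightarrow> dist (f x) (f y) \<le> C * dist x y"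
  shows "hausdorff_dim (f ` A) \<le> hausdorff_dim A"
proof -
  have "hausdorff_measure s (f ` A) = 0" if s: "0 \<le> s" "hausdorff_measure s A = 0" for s
  proof -
    have "hausdorff_premeasure s \<delta> (f ` A) = 0" if "\<delta> > 0" for \<delta>
    proof -
      have "0 < \<delta> / C" using that assms by simp
      then have "hausdorff_premeasure s (\<delta> / C) A \<le> hausdorff_measure s A"
        unfolding hausdorff_measure_def by (intro SUP_upper) auto
      then have "hausdorff_premeasure s (\<delta> / C) A = 0" using s by simp
      then show ?thesis
        using hausdorff_premeasure_lipschitz_image[OF s(1) assms(1), of A f "\<delta> / C"] lip assms(1) by simp
    qed
    then have "hausdorff_measure s (f ` A) \<le> 0"
      unfolding hausdorff_measure_def by (intro SUP_least) auto
    then show ?thesis by simp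
  qed
  then show ?thesis unfolding hausdorff_dim_def by (intro Inf_superset_mono) auto
qed

text \<open>
  The hypotheses give \<open>u (r / c) / \<kappa> \<le> v r \<le> \<kappa> * u (c * r)\<close>. After division by \<open>ln r\<close> the constant
  \<open>ln \<kappa>\<close> vanishes in the limit, and so does the rescaling of the argument because
  \<open>ln (k * r) / ln r\<close> tends to \<open>1\<close>. The two bounds change places because \<open>ln r < 0\<close>.
\<close>

lemma log_ratio_transfer:
  fixes u v :: "real \<Rightarrow> real"
  assumes "0 < \<kappa>" "0 < c"
    and u: "\<And>r. 0 < r \<Longrightarrow> 0 < u r" and v: "\<And>r. 0 < r \<Longrightarrow> 0 < v r"
    and uv: "\<And>r. 0 < r \<Longrightarrow> u r \<le> \<kappa> * v (c * r)" and vu: "\<And>r. 0 < r \<Longrightarrow> v r \<le> \<kappa> * u (c * r)"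
    and lim: "((\<lambda>r. ln (u r) / ln r) \<longlongrightarrow> \<alpha>) (at_right 0)"
  shows "((\<lambda>r. ln (v r) / ln r) \<longlongrightarrow> \<alpha>) (at_right 0)"
proof -
  have scaled: "((\<lambda>r. ln (u (k * r)) / ln r) \<longlongrightarrow> \<alpha>) (at_right 0)" if k: "0 < k" for k
  proof -
    have "filterlim (\<lambda>r. k * r) (at_right 0) (at_right (0::real))"
      using k by real_asymp
    from filterlim_compose[OF lim this]
    have "((\<lambda>r. ln (u (k * r)) / ln (k * r)) \<longlongrightarrow> \<alpha>) (at_right 0)" .
    moreover have "((\<lambda>r. ln (k * r) / ln r) \<longlongrightarrow> 1) (at_right (0::real))"
      using k by real_asymp
    ultimately have prod: "((\<lambda>r. ln (u (k * r)) / ln (k * r) * (ln (k * r) / ln r)) \<longlongrightarrow> \<alpha> * 1) (at_right 0)"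
      by (rule tendsto_mult)
    have "\<forall>\<^sub>F r in at_right 0. ln (u (k * r)) / ln (k * r) * (ln (k * r) / ln r) = ln (u (k * r)) / ln r"
    proof -
      have "\<forall>\<^sub>F r in at_right (0::real). ln (k * r) < 0" using k by real_asymp
      then show ?thesis by eventually_elim simp
    qed
    from Lim_transform_eventually[OF prod this] show ?thesis by simp
  qed
  have const: "((\<lambda>r. ln \<kappa> / ln r) \<longlongrightarrow> 0) (at_right (0::real))" by real_asymp
  have l: "((\<lambda>r. ln (u (c * r)) / ln r + ln \<kappa> / ln r) \<longlongrightarrow> \<alpha>) (at_right 0)"
    using tendsto_add[OF scaled[OF assms(2)] const] by simp
  have h: "((\<lambda>r. ln (u (inverse c * r)) / ln r - ln \<kappa> / ln r) \<longlongrightarrow> \<alpha>) (at_right 0)"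
    using tendsto_diff[OF scaled[of "inverse c"] const] assms(2) by simp
  have ev: "\<forall>\<^sub>F r in at_right (0::real). 0 < r \<and> ln r < 0"
    by (intro eventually_conj; real_asymp)
  show ?thesis
  proof (rule tendsto_sandwich[OF _ _ l h])
    show "\<forall>\<^sub>F r in at_right 0. ln (u (c * r)) / ln r + ln \<kappa> / ln r \<le> ln (v r) / ln r"
      using ev
    proof eventually_elim
      case (elim r)
      have "ln (v r) \<le> ln (\<kappa> * u (c * r))" using vu v elim assms by (intro ln_mono) auto
      also have "\<dots> = ln (u (c * r)) + ln \<kappa>" using u elim assms by (simp add: ln_mult_pos)
      finally have "ln (v r) \<le> ln (u (c * r)) + ln \<kappa>" .
      from divide_right_mono_neg[OF this, of "ln r"] elim show ?case
        unfolding add_divide_distrib by linarith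
    qed
    show "\<forall>\<^sub>F r in at_right 0. ln (v r) / ln r \<le> ln (u (inverse c * r)) / ln r - ln \<kappa> / ln r"
      using ev
    proof eventually_elim
      case (elim r)
      then have "0 < inverse c * r" using assms by simp
      have "c * (inverse c * r) = r" using assms(2) by simp
      then have "u (inverse c * r) \<le> \<kappa> * v r" "0 < u (inverse c * r)"
        using uv[OF \<open>0 < inverse c * r\<close>] u[OF \<open>0 < inverse c * r\<close>] by (simp_all only:)
      then have "ln (u (inverse c * r)) \<le> ln (\<kappa> * v r)" by (intro ln_mono)
      also have "\<dots> = ln (v r) + ln \<kappa>" using v elim assms by (simp add: ln_mult_pos)
      finally have "ln (u (inverse c * r)) - ln \<kappa> \<le> ln (v r)" by simp
      from divide_right_mono_neg[OF this, of "ln r"] elim show ?case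
        unfolding diff_divide_distrib by linarith
    qed
  qed
qed

definition balls_dominated :: "real \<Rightarrow> real \<Rightarrow> 'a::metric_space measure \<Rightarrow> 'b::metric_space measure \<Rightarrow> ('a \<Rightarrow> 'b) \<Rightarrow> bool" where
  "balls_dominated \<kappa> c M M' f \<longleftrightarrow> (\<forall>x\<in>space M. \<forall>r>0.
     measure M (ball x r \<inter> space M) \<le> \<kappa> * measure M' (ball (f x) (c * r) \<inter> space M'))"

lemma has_local_dim_transfer:
  assumes "balls_dominated \<kappa> c M M' f" "balls_dominated \<kappa> c M' M g" "0 < \<kappa>" "0 < c"
    and x: "x \<in> space M" "f x \<in> space M'" "g (f x) = x" and dim: "has_local_dim M x \<alpha>"
  shows "has_local_dim M' (f x) \<alpha>"
proof -
  define u where "u r = measure M (ball x r \<inter> space M)" for r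
  define v where "v r = measure M' (ball (f x) r \<inter> space M')" for r
  have uv: "u r \<le> \<kappa> * v (c * r)" "v r \<le> \<kappa> * u (c * r)" if "0 < r" for r
    using assms that unfolding balls_dominated_def u_def v_def by metis+
  have u: "0 < u r" if "0 < r" for r using dim that unfolding has_local_dim_def u_def by auto
  have v: "0 < v r" if "0 < r" for r
  proof -
    have "0 < r / c" using that assms by simp
    then have "0 < \<kappa> * v r" using uv(1)[of "r / c"] u[of "r / c"] assms by simp
    then show ?thesis using assms by (simp add: zero_less_mult_iff)
  qed
  have "((\<lambda>r. ln (v r) / ln r) \<longlongrightarrow> \<alpha>) (at_right 0)"
  proof (rule log_ratio_transfer[where u = u and v = v, OF assms(3,4)])
    show "((\<lambda>r. ln (u r) / ln r) \<longlongrightarrow> \<alpha>) (at_right 0)"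
      using dim unfolding has_local_dim_def u_def by blast
  qed (use u v uv in auto)
  then show ?thesis using v unfolding has_local_dim_def v_def by auto
qed

text \<open>
  For a finite measure the extended real inequalities and the finiteness clause reduce to one
  inequality between reals, and the constant may be enlarged to be at least \<open>1\<close>.
\<close>

lemma doubling_measure_iff:
  assumes "finite_measure M"
  shows "doubling_measure M \<longleftrightarrow> (\<exists>C. \<forall>x\<in>space M. \<forall>r>0.
     0 < measure M (ball x (2 * r) \<inter> space M) \<and>
     measure M (ball x (2 * r) \<inter> space M) \<le> C * measure M (ball x r \<inter> space M))"
proof -
  interpret finite_measure M by fact
  have eq: "(0 < emeasure M S \<and> emeasure M S \<le> ennreal C * emeasure M T \<and> ennreal C * emeasure M T < \<infinity>) \<longleftrightarrow>
      0 < measure M S \<and> measure M S \<le> C * measure M T" if "1 \<le> C" for S T C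
    using that by (simp add: emeasure_eq_measure ennreal_mult'[symmetric] ennreal_less_top)
  show ?thesis
  proof
    assume "doubling_measure M"
    then show "\<exists>C. \<forall>x\<in>space M. \<forall>r>0. 0 < measure M (ball x (2 * r) \<inter> space M) \<and>
     measure M (ball x (2 * r) \<inter> space M) \<le> C * measure M (ball x r \<inter> space M)"
      unfolding doubling_measure_def using eq by metis
  next
    assume "\<exists>C. \<forall>x\<in>space M. \<forall>r>0. 0 < measure M (ball x (2 * r) \<inter> space M) \<and>
     measure M (ball x (2 * r) \<inter> space M) \<le> C * measure M (ball x r \<inter> space M)"
    then obtain C where C: "\<forall>x\<in>space M. \<forall>r>0. 0 < measure M (ball x (2 * r) \<inter> space M) \<and>
     measure M (ball x (2 * r) \<inter> space M) \<le> C * measure M (ball x r \<inter> space M)" by blast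
    have "C * measure M S \<le> max 1 C * measure M S" for S by (intro mult_right_mono) auto
    then have "\<forall>x\<in>space M. \<forall>r>0. 0 < measure M (ball x (2 * r) \<inter> space M) \<and>
     measure M (ball x (2 * r) \<inter> space M) \<le> max 1 C * measure M (ball x r \<inter> space M)"
      using C order_trans by blast
    then show "doubling_measure M"
      unfolding doubling_measure_def using eq[of "max 1 C"] by (intro exI[of _ "max 1 C"]) auto
  qed
qed

text \<open>
  Passing from \<open>M'\<close> to \<open>M\<close> and back enlarges the ratio of the two radii from \<open>2\<close> to \<open>2 c\<^sup>2\<close>, which is
  absorbed by finitely many doublings in \<open>M\<close>.
\<close>

lemma doubling_measure_transfer:
  assumes "finite_measure M" "finite_measure M'"
    and "balls_dominated \<kappa> c M M' f" "balls_dominated \<kappa> c M' M g" "0 < \<kappa>" "0 < c"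
    and balls: "\<And>x r. ball x r \<inter> space M \<in> sets M"
    and g: "\<And>y. y \<in> space M' \<Longrightarrow> g y \<in> space M" "\<And>y. y \<in> space M' \<Longrightarrow> f (g y) = y"
    and "doubling_measure M"
  shows "doubling_measure M'"
proof -
  interpret M: finite_measure M by fact
  obtain C where C: "\<And>x r. x \<in> space M \<Longrightarrow> 0 < r \<Longrightarrow> 0 < measure M (ball x (2 * r) \<inter> space M)"
    "\<And>x r. x \<in> space M \<Longrightarrow> 0 < r \<Longrightarrow>
      measure M (ball x (2 * r) \<inter> space M) \<le> C * measure M (ball x r \<inter> space M)"
    using assms(10) unfolding doubling_measure_iff[OF assms(1)] by blast
  define C' where "C' = max 0 C"
  have C': "measure M (ball x (2 * r) \<inter> space M) \<le> C' * measure M (ball x r \<inter> space M)"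
    if "x \<in> space M" "0 < r" for x r
    using C(2)[OF that] mult_right_mono[of C C' "measure M (ball x r \<inter> space M)"] by (simp add: C'_def)
  have iter: "measure M (ball x (2 ^ k * r) \<inter> space M) \<le> C' ^ k * measure M (ball x r \<inter> space M)"
    if "x \<in> space M" "0 < r" for x r k
  proof (induction k)
    case (Suc k)
    have "measure M (ball x (2 ^ Suc k * r) \<inter> space M) \<le> C' * measure M (ball x (2 ^ k * r) \<inter> space M)"
      using C'[of x "2 ^ k * r"] that by (simp add: mult.assoc)
    also have "\<dots> \<le> C' * (C' ^ k * measure M (ball x r \<inter> space M))"
      using Suc by (intro mult_left_mono) (auto simp: C'_def)
    finally show ?case by (simp add: mult.assoc)
  qed simp
  obtain k where k: "2 * c * c < 2 ^ k" using real_arch_pow[of 2 "2 * c * c"] by auto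
  have "0 < measure M' (ball y (2 * r) \<inter> space M') \<and>
     measure M' (ball y (2 * r) \<inter> space M') \<le> (\<kappa> * C' ^ k * \<kappa>) * measure M' (ball y r \<inter> space M')"
    if y: "y \<in> space M'" and r: "0 < r" for y r
  proof
    let ?x = "g y"
    have x: "?x \<in> space M" "f ?x = y" using g y by auto
    have up: "measure M (ball ?x s \<inter> space M) \<le> \<kappa> * measure M' (ball y (c * s) \<inter> space M')"
      and low: "measure M' (ball y s \<inter> space M') \<le> \<kappa> * measure M (ball ?x (c * s) \<inter> space M)"
      if "0 < s" for s
      using assms(3,4) x y that unfolding balls_dominated_def by metis+
    have "0 < measure M (ball ?x (2 * (r / c)) \<inter> space M)" using C(1)[OF x(1), of "r / c"] r assms(6) by simp
    also have "\<dots> \<le> \<kappa> * measure M' (ball y (2 * r) \<inter> space M')"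
      using up[of "2 * (r / c)"] r assms by simp
    finally show "0 < measure M' (ball y (2 * r) \<inter> space M')" using assms by (simp add: zero_less_mult_iff)
    have "c * (2 * r) \<le> 2 ^ k * (r / c)"
      using k r assms by (simp add: field_simps)
    then have "measure M (ball ?x (c * (2 * r)) \<inter> space M) \<le> measure M (ball ?x (2 ^ k * (r / c)) \<inter> space M)"
      using balls x by (intro M.finite_measure_mono Int_mono subset_ball) auto
    also have "\<dots> \<le> C' ^ k * measure M (ball ?x (r / c) \<inter> space M)"
      using iter[OF x(1), of "r / c" k] r assms(6) by simp
    also have "\<dots> \<le> C' ^ k * (\<kappa> * measure M' (ball y r \<inter> space M'))"
      using up[of "r / c"] r assms by (intro mult_left_mono) (auto simp: C'_def)
    finally have "\<kappa> * measure M (ball ?x (c * (2 * r)) \<inter> space M) \<le>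
        \<kappa> * (C' ^ k * (\<kappa> * measure M' (ball y r \<inter> space M')))"
      using assms by (intro mult_left_mono) auto
    then show "measure M' (ball y (2 * r) \<inter> space M') \<le> (\<kappa> * C' ^ k * \<kappa>) * measure M' (ball y r \<inter> space M')"
      using low[of "2 * r"] r by (simp add: mult.assoc)
  qed
  then show ?thesis unfolding doubling_measure_iff[OF assms(2)] by blast
qed

theorem corollary1p1:
  fixes n m :: nat
    and D\<^sub>E D\<^sub>F :: "(nat \<times> nat) set"
    and E F :: "(real \<times> real) set"
    and \<mu>\<^sub>E \<mu>\<^sub>F :: "(real \<times> real) measure"
  assumes "2 \<le> m" and "m < n"
    and "self_affine_carpet n m D\<^sub>E E" and "self_affine_carpet n m D\<^sub>F F"
    and "totally_disconnected E" and "totally_disconnected F"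
    and "uniform_bernoulli_measure n m D\<^sub>E E \<mu>\<^sub>E"
    and "uniform_bernoulli_measure n m D\<^sub>F F \<mu>\<^sub>F"
    and "lipschitz_equivalent E F"
  shows "(\<forall>\<alpha>. multifractal_spectrum \<mu>\<^sub>E \<alpha> = multifractal_spectrum \<mu>\<^sub>F \<alpha>) \<and>
         (doubling_measure \<mu>\<^sub>E \<longleftrightarrow> doubling_measure \<mu>\<^sub>F)"
proof -
  obtain f g C where img: "f ` E = F" "g ` F = E" and C: "1 \<le> C"
    and inv: "\<And>x. x \<in> E \<Longrightarrow> g (f x) = x" "\<And>y. y \<in> F \<Longrightarrow> f (g y) = y"
    and f: "\<And>x y. x \<in> E \<Longrightarrow> y \<in> E \<Longrightarrow> dist (f x) (f y) \<le> C * dist x y"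
    and g: "\<And>x y. x \<in> F \<Longrightarrow> y \<in> F \<Longrightarrow> dist (g x) (g y) \<le> C * dist x y"
    by (rule lipschitz_equivalent_inverse_pair[OF assms(9)], rule that)
  have sp: "space \<mu>\<^sub>E = E" "space \<mu>\<^sub>F = F"
    using uniform_bernoulli_space assms(7,8) by auto
  have fin: "finite_measure \<mu>\<^sub>E" "finite_measure \<mu>\<^sub>F"
    using assms(7,8) unfolding uniform_bernoulli_measure_def by (auto intro: prob_space.finite_measure)
  have mem: "\<And>x. x \<in> E \<Longrightarrow> f x \<in> F" "\<And>y. y \<in> F \<Longrightarrow> g y \<in> E" using img by auto
  have f': "dist x y \<le> C * dist (f x) (f y)" if "x \<in> E" "y \<in> E" for x y
    using g[of "f x" "f y"] mem inv that by simp
  have g': "dist x y \<le> C * dist (g x) (g y)" if "x \<in> F" "y \<in> F" for x y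
    using f[of "g x" "g y"] mem inv that by simp
  obtain \<kappa>1 where k1: "0 < \<kappa>1" "balls_dominated \<kappa>1 (2 * C) \<mu>\<^sub>E \<mu>\<^sub>F f"
    using ball_measure_le[OF assms(1-4,7,8) img C f f' g'] unfolding balls_dominated_def sp by blast
  obtain \<kappa>2 where k2: "0 < \<kappa>2" "balls_dominated \<kappa>2 (2 * C) \<mu>\<^sub>F \<mu>\<^sub>E g"
    using ball_measure_le[OF assms(1,2,4,3,8,7) img(2,1) C g g' f'] unfolding balls_dominated_def sp by blast
  define \<kappa> where "\<kappa> = max \<kappa>1 \<kappa>2"
  have weaken: "balls_dominated \<kappa> c M M' h" if "balls_dominated k c M M' h" "k \<le> \<kappa>"
    for k c and M M' :: "(real \<times> real) measure" and h
    using that unfolding balls_dominated_def by (meson measure_nonneg mult_right_mono order_trans)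
  have dom: "balls_dominated \<kappa> (2 * C) \<mu>\<^sub>E \<mu>\<^sub>F f" "balls_dominated \<kappa> (2 * C) \<mu>\<^sub>F \<mu>\<^sub>E g"
    using weaken k1 k2 by (auto simp: \<kappa>_def)
  have pos: "0 < \<kappa>" "0 < 2 * C" using k1 C by (auto simp: \<kappa>_def)
  have spec: "multifractal_spectrum \<mu>\<^sub>E \<alpha> = multifractal_spectrum \<mu>\<^sub>F \<alpha>" for \<alpha>
  proof -
    let ?X = "{x \<in> E. has_local_dim \<mu>\<^sub>E x \<alpha>}" and ?Y = "{y \<in> F. has_local_dim \<mu>\<^sub>F y \<alpha>}"
    have fX: "f ` ?X \<subseteq> ?Y"
      using has_local_dim_transfer[OF dom pos] mem inv by (auto simp: sp)
    have gY: "g ` ?Y \<subseteq> ?X"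
      using has_local_dim_transfer[OF dom(2,1) pos] mem inv by (auto simp: sp)
    have "f ` ?X = ?Y" "g ` ?Y = ?X"
      using fX gY inv by force+
    moreover have "hausdorff_dim (f ` ?X) \<le> hausdorff_dim ?X" "hausdorff_dim (g ` ?Y) \<le> hausdorff_dim ?Y"
      using C f g by (auto intro!: hausdorff_dim_lipschitz_image[of C])
    ultimately show ?thesis unfolding multifractal_spectrum_def sp by simp
  qed
  have "doubling_measure \<mu>\<^sub>E \<longleftrightarrow> doubling_measure \<mu>\<^sub>F"
    using doubling_measure_transfer[OF fin dom pos] doubling_measure_transfer[OF fin(2,1) dom(2,1) pos]
      uniform_bernoulli_ball_measurable[OF assms(7)] uniform_bernoulli_ball_measurable[OF assms(8)]
      mem inv unfolding sp by blast
  with spec show ?thesis by blast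
qed

end
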